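(* Let $p$ be an odd prime, let $s\ge 1$ and $m=2s\geq 4$, let $l$ be an integer with $1\le l\le m-1$, $l\neq s$, and put $q=p^m$. Let $$\mathcal{D}={\overline{\mathbb{C}^\bot}}^\bot=\Big\{\big(Tr_s(ax^{p^s+1})+Tr_m(bx^{p^l+1}+cx)+h\big)_{x\in\mathbb{F}_q} : a\in\mathbb{F}_{p^s},\ b,c\in\mathbb{F}_q,\ h\in\mathbb{F}_p\Big\}\subseteq \mathbb{F}_p^{\,q}.$$ For every $i>0$ such that $\mathcal{D}$ contains a codeword of Hamming weight $i$, let $\mathcal{B}_i$ be the set of supports of all codewords of weight $i$ in $\mathcal{D}$. Then $(\mathbb{F}_q,\mathcal{B}_i)$ is a $2$-design, i.e. a $2$-$(p^m,i,\lambda)$ design for some $\lambda$.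
   Context: For a positive integer $r$, $Tr_r(x)=x+x^p+\cdots+x^{p^{r-1}}$ is the absolute trace from $\mathbb{F}_{p^r}$ to $\mathbb{F}_p$. The support of a codeword $(c_x)_{x\in\mathbb{F}_q}$ is $\{x\in\mathbb{F}_q: c_x\ne 0\}$, and its Hamming weight is the size of the support. For integers $1\le t\le k\le v$, a $t$-$(v,k,\lambda)$ design is a pair $(\mathcal{P},\mathcal{B})$ with $\mathcal{P}$ a set of $v$ points and $\mathcal{B}$ a collection of $k$-subsets (blocks) of $\mathcal{P}$ such that every $t$-subset of $\mathcal{P}$ is contained in exactly $\lambda$ blocks. The notation ${\overline{\mathbb{C}^\bot}}^\bot$ indicates that the code is the dual of the extended code of the dual of the non-binary Kasami cyclic code $\mathbb{C}$ (the cyclic code of length $q-1$ over $\mathbb{F}_p$ with parity-check polynomial $h_1h_{p^s+1}h_{p^l+1}$, where $h_j$ is the minimal polynomial over $\mathbb{F}_p$ of $\alpha^j$, $\alpha$ a primitive element of $\mathbb{F}_q$); the explicit description in the claim is the one to be used. *)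

theory Defs
  imports "HOL-Number_Theory.Number_Theory" "HOL-Computational_Algebra.Computational_Algebra" "HOL-Library.Cardinality"
begin

text \<open>
  The field of order \<open>q = p ^ m\<close> is a type of class \<^class>\<open>finite_field\<close> with \<open>p ^ m\<close> elements.
  Its subfields are sets of elements of that type: for \<open>r\<close> dividing \<open>m\<close>, the subfield of order
  \<open>n = p ^ r\<close> consists of the roots of \<open>X ^ n - X\<close>. The lemmas below confirm that this set is a
  subfield and has \<open>p ^ r\<close> elements.
\<close>

definition subfield_of_order :: "nat \<Rightarrow> 'a::field set" where
  "subfield_of_order n = {x. x ^ n = x}"

lemma char_eq_if_card_eq:
  assumes "prime p" and card: "CARD('a::finite_field) = p ^ m"
  shows "CHAR('a) = p"
proof -
  have "prime CHAR('a)"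
    by (rule prime_CHAR_semidom) (rule CHAR_pos)
  moreover have "CHAR('a) dvd p ^ m"
    using CHAR_dvd_CARD[where ?'a = 'a] card by simp
  ultimately show ?thesis
    using \<open>prime p\<close> by (metis prime_dvd_power primes_dvd_imp_eq)
qed

lemma subfield_of_order_closed:
  fixes x y :: "'a::finite_field"
  assumes "prime p" and "CARD('a) = p ^ m"
    and "x \<in> subfield_of_order (p ^ r)" and "y \<in> subfield_of_order (p ^ r)"
  shows "x + y \<in> subfield_of_order (p ^ r)"
    and "x * y \<in> subfield_of_order (p ^ r)"
    and "- x \<in> subfield_of_order (p ^ r)"
    and "inverse x \<in> subfield_of_order (p ^ r)"
    and "(0::'a) \<in> subfield_of_order (p ^ r)"
    and "(1::'a) \<in> subfield_of_order (p ^ r)"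
proof -
  have char: "CHAR('a) = p"
    by (rule char_eq_if_card_eq) fact+
  have add: "(u + v) ^ p ^ r = u ^ p ^ r + v ^ p ^ r" for u v :: 'a
    by (rule freshmans_dream') (use char \<open>prime p\<close> in auto)
  have "p ^ r > 0"
    using \<open>prime p\<close> by (simp add: prime_gt_0_nat)
  then have zero: "(0::'a) ^ p ^ r = 0"
    by (simp add: power_0_left)
  show "- x \<in> subfield_of_order (p ^ r)"
    using add[of x "- x"] assms(3) zero
    by (simp add: subfield_of_order_def) (metis add_eq_0_iff)
  show "x + y \<in> subfield_of_order (p ^ r)"
    and "x * y \<in> subfield_of_order (p ^ r)"
    and "inverse x \<in> subfield_of_order (p ^ r)"
    and "(0::'a) \<in> subfield_of_order (p ^ r)"
    and "(1::'a) \<in> subfield_of_order (p ^ r)"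
    using assms(3,4) add zero
    by (simp_all add: subfield_of_order_def power_mult_distrib power_inverse)
qed

lemma card_roots_of_unity_le:
  assumes "n > 0"
  shows "card {x::'a::finite_field. x ^ n = c} \<le> n"
proof -
  let ?f = "monom 1 n - [:c:] :: 'a poly"
  have deg: "degree ?f \<le> n"
    by (rule degree_diff_le) (simp_all add: degree_monom_le)
  have "coeff ?f n = 1"
    using assms by (simp add: coeff_pCons split: nat.splits)
  then have "?f \<noteq> 0"
    by (metis coeff_0 zero_neq_one)
  then have "card {x. poly ?f x = 0} \<le> degree ?f"
    by (rule card_poly_roots_bound)
  with deg show ?thesis
    by (simp add: poly_monom)
qed

lemma card_subfield_of_order:
  assumes "prime p" and card: "CARD('a::finite_field) = p ^ m" and "r dvd m" and "r > 0"
  shows "card (subfield_of_order (p ^ r) :: 'a set) = p ^ r"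
proof -
  let ?U = "UNIV - {0} :: 'a set"
  define n where "n = p ^ r - 1"
  have "p ^ r > 1"
    using \<open>r > 0\<close> prime_gt_1_nat[OF \<open>prime p\<close>] by (rule one_less_power[rotated])
  then have n: "n > 0" "p ^ r = Suc n"
    by (simp_all add: n_def)
  have card_U: "card ?U = p ^ m - 1"
    by (subst card_Diff_singleton) (simp_all add: card)
  have "card ?U > 0"
    by (metis Diff_iff UNIV_I card_gt_0_iff empty_iff finite singletonD zero_neq_one)
  obtain t where t: "m = r * t"
    using \<open>r dvd m\<close> by blast
  have "[p ^ r = 1] (mod n)"
    using n by (metis cong_add_rcancel_0_nat plus_1_eq_Suc add.commute cong_0_iff dvd_refl)
  from cong_pow[OF this, of t] have "[1 = p ^ m] (mod n)"
    by (simp add: t power_mult cong_sym)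
  moreover have "1 \<le> p ^ m"
    using \<open>prime p\<close> by (simp add: Suc_le_eq prime_gt_0_nat)
  ultimately have "n dvd p ^ m - 1"
    by (metis cong_altdef_nat cong_sym)
  then obtain k where k: "card ?U = n * k"
    using card_U by auto
  with \<open>card ?U > 0\<close> have "k > 0"
    by (cases k) simp_all
  have "x ^ card ?U = 1" if "x \<noteq> 0" for x :: 'a
  proof -
    have "x * x ^ card ?U = x ^ p ^ m"
      using \<open>1 \<le> p ^ m\<close> by (metis Suc_diff_1 Suc_le_eq card_U One_nat_def power_Suc)
    also have "\<dots> = x"
      using finite_field_power_card_eq_same[of x] card by simp
    finally show ?thesis
      using that by simp
  qed
  then have img: "(\<lambda>x. x ^ k) ` ?U \<subseteq> {y. y ^ n = 1}"
    by (auto simp: k mult.commute simp flip: power_mult)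
  have "n * k = card (\<Union>y\<in>(\<lambda>x. x ^ k) ` ?U. {x \<in> ?U. x ^ k = y})"
    unfolding k[symmetric] by (rule arg_cong[where f = card]) auto
  also have "\<dots> \<le> (\<Sum>y\<in>(\<lambda>x. x ^ k) ` ?U. card {x \<in> ?U. x ^ k = y})"
    by (rule card_UN_le) simp
  also have "\<dots> \<le> (\<Sum>y\<in>(\<lambda>x. x ^ k) ` ?U. k)"
    by (intro sum_mono order_trans[OF card_mono card_roots_of_unity_le[OF \<open>k > 0\<close>]]) auto
  also have "\<dots> \<le> card {y::'a. y ^ n = 1} * k"
    using card_mono[OF _ img] by simp
  finally have "card {y::'a. y ^ n = 1} = n"
    using \<open>k > 0\<close> card_roots_of_unity_le[OF \<open>n > 0\<close>, of "1::'a"] by simp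
  moreover have "subfield_of_order (p ^ r) = insert 0 {y::'a. y ^ n = 1}"
    by (auto simp: subfield_of_order_def n)
  moreover have "(0::'a) \<notin> {y. y ^ n = 1}"
    using \<open>n > 0\<close> by (simp add: power_0_left)
  ultimately show ?thesis
    by (simp add: n)
qed

text \<open>
  The trace from the field of order \<open>p ^ r\<close> to its prime subfield; only meant for arguments in
  \<^term>\<open>subfield_of_order (p ^ r)\<close>.
\<close>

definition abs_trace :: "nat \<Rightarrow> nat \<Rightarrow> 'a::field \<Rightarrow> 'a" where
  "abs_trace p r x = (\<Sum>i<r. x ^ (p ^ i))"

lemma abs_trace_in_prime_subfield:
  fixes x :: "'a::finite_field"
  assumes "prime p" and "CARD('a) = p ^ m" and "r > 0" and "x \<in> subfield_of_order (p ^ r)"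
  shows "abs_trace p r x \<in> subfield_of_order p"
proof -
  have char: "CHAR('a) = p"
    by (rule char_eq_if_card_eq) fact+
  have "abs_trace p r x ^ p = (\<Sum>i<r. (x ^ p ^ i) ^ p)"
    unfolding abs_trace_def by (rule freshmans_dream_sum) (use char \<open>prime p\<close> in auto)
  also have "\<dots> = (\<Sum>i<r. x ^ p ^ Suc i)"
    by (simp add: mult.commute flip: power_mult)
  also have "\<dots> = abs_trace p r x + x ^ p ^ r - x"
    unfolding abs_trace_def by (induction r) simp_all
  finally show ?thesis
    using assms(4) by (simp add: subfield_of_order_def)
qed

text \<open>
  Words of length \<open>q\<close> over the prime field are functions on the field of order \<open>q\<close> with values
  in its prime subfield. The code below is the dual of the extended code of the dual of the
  non-binary Kasami cyclic code, in its explicit trace description.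
\<close>

definition kasami_codeword ::
    "nat \<Rightarrow> nat \<Rightarrow> nat \<Rightarrow> nat \<Rightarrow> 'a::field \<Rightarrow> 'a \<Rightarrow> 'a \<Rightarrow> 'a \<Rightarrow> 'a \<Rightarrow> 'a" where
  "kasami_codeword p s m l a b c h x =
     abs_trace p s (a * x ^ (p ^ s + 1)) + abs_trace p m (b * x ^ (p ^ l + 1) + c * x) + h"

definition extended_kasami_code :: "nat \<Rightarrow> nat \<Rightarrow> nat \<Rightarrow> nat \<Rightarrow> ('a::field \<Rightarrow> 'a) set" where
  "extended_kasami_code p s m l =
     {kasami_codeword p s m l a b c h | a b c h.
        a \<in> subfield_of_order (p ^ s) \<and> h \<in> subfield_of_order p}"

lemma extended_kasami_code_prime_subfield:
  fixes w :: "'a::finite_field \<Rightarrow> 'a"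
  assumes p: "prime p" and card: "CARD('a) = p ^ m" and m: "m = 2 * s" and "s \<ge> 1"
    and "w \<in> extended_kasami_code p s m l"
  shows "w x \<in> subfield_of_order p"
proof -
  obtain a b c h where w: "w = kasami_codeword p s m l a b c h"
    and ah: "a \<in> subfield_of_order (p ^ s)" "h \<in> subfield_of_order p"
    using assms(5) by (auto simp: extended_kasami_code_def)
  have all: "y ^ p ^ m = y" for y :: 'a
    using finite_field_power_card_eq_same[of y] card by simp
  have "(x ^ (p ^ s + 1)) ^ p ^ s = x ^ (p ^ m + p ^ s)"
    unfolding power_mult[symmetric] by (simp add: m mult_2 power_add distrib_right)
  also have "\<dots> = x ^ (p ^ s + 1)"
    by (simp add: power_add all)
  finally have "a * x ^ (p ^ s + 1) \<in> subfield_of_order (p ^ s)"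
    using ah by (simp add: subfield_of_order_def power_mult_distrib)
  then have "abs_trace p s (a * x ^ (p ^ s + 1)) \<in> subfield_of_order p"
    by (rule abs_trace_in_prime_subfield[OF p card, rotated]) (use \<open>s \<ge> 1\<close> in simp)
  moreover have "abs_trace p m (b * x ^ (p ^ l + 1) + c * x) \<in> subfield_of_order p"
    by (rule abs_trace_in_prime_subfield[OF p card])
      (unfold subfield_of_order_def all mem_Collect_eq, use m \<open>s \<ge> 1\<close> in simp_all)
  ultimately show ?thesis
    using subfield_of_order_closed(1)[OF p card, where r = 1] ah
    by (simp add: w kasami_codeword_def)
qed

definition codeword_support :: "('a \<Rightarrow> 'b::zero) \<Rightarrow> 'a set" where
  "codeword_support w = {x. w x \<noteq> 0}"

definition hamming_weight :: "('a \<Rightarrow> 'b::zero) \<Rightarrow> nat" where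
  "hamming_weight w = card (codeword_support w)"

definition blocks_of_weight :: "('a \<Rightarrow> 'b::zero) set \<Rightarrow> nat \<Rightarrow> 'a set set" where
  "blocks_of_weight C i = codeword_support ` {w \<in> C. hamming_weight w = i}"

definition is_design :: "nat \<Rightarrow> nat \<Rightarrow> nat \<Rightarrow> nat \<Rightarrow> 'a set \<Rightarrow> 'a set set \<Rightarrow> bool" where
  "is_design t v k lam P B \<longleftrightarrow>
     1 \<le> t \<and> t \<le> k \<and> k \<le> v \<and> finite P \<and> card P = v \<and>
     (\<forall>b\<in>B. b \<subseteq> P \<and> card b = k) \<and>
     (\<forall>T. T \<subseteq> P \<and> card T = t \<longrightarrow> card {b \<in> B. T \<subseteq> b} = lam)"

end

theory Submission
  imports Defs
begin

text \<open>
  The supports form a 2-design because the code is invariant under the affine group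
  \<open>x \<mapsto> u * x + v\<close> (\<open>u \<noteq> 0\<close>) of the field, which is doubly transitive on the points: an
  affine map that carries one pair of points to another also carries the blocks through the first
  pair to blocks through the second, so all pairs lie on equally many blocks
  (\<open>affine_invariant_code_design\<close>).

  Invariance (\<open>extended_kasami_code_affine\<close>) holds because expanding \<open>(u * x + v) ^ (p ^ j + 1)\<close>
  yields, besides the leading term, only terms in \<open>x ^ p ^ j\<close> and \<open>x\<close> and a constant.
  Since the trace does not change when its argument is raised to the power \<open>p\<close>, the two middle
  terms become a single linear term \<open>Tr\<^sub>m (c * x)\<close>. For \<open>j = s\<close> they are conjugate over the
  subfield of order \<open>p ^ s\<close>, and their sum is absorbed by transitivity of the trace.

  A 2-design needs blocks with at least two points, so words of weight 1 must be excluded. As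
  functions of \<open>x\<close> on the field, with \<open>q\<close> elements, the words are sums of a constant and traces of
  polynomials of degree below \<open>q - 1\<close>. Power sums of positive degree below \<open>q - 1\<close> vanish, and
  so does the sum of a constant, since \<open>q\<close> is a multiple of the characteristic. Hence the values of
  every word sum to zero (\<open>sum_extended_kasami_codeword\<close>), whereas those of a word of weight 1 sum
  to its only nonzero entry.
\<close>

section \<open>Designs from affine-invariant codes\<close>

text \<open>
  Double transitivity of the affine group: the map is the line through the points \<open>(x1, x2)\<close>
  and \<open>(y1, y2)\<close>.
\<close>

lemma affine_map_between_pairs:
  fixes T1 T2 :: "'a::field set"
  assumes "card T1 = 2" and "card T2 = 2"
  obtains u v where "u \<noteq> 0" and "(\<lambda>x. u * x + v) ` T1 = T2"
proof -
  obtain x1 y1 where T1: "T1 = {x1, y1}" "x1 \<noteq> y1"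
    using assms(1) by (auto simp: card_2_iff)
  obtain x2 y2 where T2: "T2 = {x2, y2}" "x2 \<noteq> y2"
    using assms(2) by (auto simp: card_2_iff)
  define u where "u = (y2 - x2) / (y1 - x1)"
  have "u * (y1 - x1) = y2 - x2"
    using T1 by (simp add: u_def)
  then have "u * y1 + (x2 - u * x1) = y2"
    by (simp add: algebra_simps)
  then have "(\<lambda>x. u * x + (x2 - u * x1)) ` T1 = T2"
    by (simp add: T1 T2)
  moreover have "u \<noteq> 0"
    using T1 T2 by (simp add: u_def)
  ultimately show thesis
    by (rule that[rotated])
qed

lemma inj_affine_map:
  fixes u v :: "'a::field"
  assumes "u \<noteq> 0"
  shows "inj (\<lambda>x. u * x + v)"
  using assms by (auto intro: injI)

lemma affine_image_block:
  fixes C :: "('a::field \<Rightarrow> 'b::zero) set"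
  assumes affine: "\<And>w u v. w \<in> C \<Longrightarrow> u \<noteq> 0 \<Longrightarrow> (\<lambda>x. w (u * x + v)) \<in> C"
    and "u \<noteq> 0" and "b \<in> blocks_of_weight C i"
  shows "(\<lambda>x. u * x + v) ` b \<in> blocks_of_weight C i"
proof -
  obtain w where w: "w \<in> C" "hamming_weight w = i" "b = codeword_support w"
    using assms(3) by (auto simp: blocks_of_weight_def)
  \<comment> \<open>The image of a support is the support of the word composed with the inverse affine map.\<close>
  define w' where "w' = (\<lambda>x. w (inverse u * x + (- v / u)))"
  have "w' \<in> C"
    unfolding w'_def using w(1) \<open>u \<noteq> 0\<close> by (intro affine) simp_all
  have supp: "(\<lambda>x. u * x + v) ` b = codeword_support w'"
  proof (intro equalityI subsetI)
    fix y assume "y \<in> (\<lambda>x. u * x + v) ` b"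
    then show "y \<in> codeword_support w'"
      using \<open>u \<noteq> 0\<close> by (auto simp: w'_def w codeword_support_def field_simps)
  next
    fix y assume "y \<in> codeword_support w'"
    then have "inverse u * y + (- v / u) \<in> b"
      by (simp add: w'_def w codeword_support_def)
    moreover have "y = u * (inverse u * y + (- v / u)) + v"
      using \<open>u \<noteq> 0\<close> by (simp add: field_simps)
    ultimately show "y \<in> (\<lambda>x. u * x + v) ` b"
      by blast
  qed
  have "hamming_weight w' = i"
    using w card_image[OF inj_on_subset[OF inj_affine_map[OF \<open>u \<noteq> 0\<close>, of v]], of b]
    by (simp add: hamming_weight_def flip: supp)
  with \<open>w' \<in> C\<close> show ?thesis
    by (auto simp: supp blocks_of_weight_def)
qed

lemma affine_invariant_code_design:
  fixes C :: "('a::{field, finite} \<Rightarrow> 'b::zero) set"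
  assumes affine: "\<And>w u v. w \<in> C \<Longrightarrow> u \<noteq> 0 \<Longrightarrow> (\<lambda>x. w (u * x + v)) \<in> C"
    and "2 \<le> i" and "i \<le> CARD('a)"
  shows "\<exists>lam. is_design 2 CARD('a) i lam (UNIV :: 'a set) (blocks_of_weight C i)"
proof -
  let ?B = "blocks_of_weight C i"
  let ?through = "\<lambda>T. {b \<in> ?B. T \<subseteq> b}"
  have le: "card (?through T1) \<le> card (?through T2)"
    if pairs: "card T1 = 2" "card T2 = 2" for T1 T2
  proof -
    obtain u v where u: "u \<noteq> 0" and T2: "(\<lambda>x. u * x + v) ` T1 = T2"
      by (rule affine_map_between_pairs[OF pairs])
    have "(`) (\<lambda>x. u * x + v) ` ?through T1 \<subseteq> ?through T2"
      using affine_image_block[OF affine u] by (auto simp flip: T2)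
    moreover have "inj_on ((`) (\<lambda>x. u * x + v)) (?through T1)"
      using inj_affine_map[OF u, of v] by (simp add: inj_on_def inj_image_eq_iff)
    ultimately show ?thesis
      by (intro card_inj_on_le[of "(`) (\<lambda>x. u * x + v)"]) simp_all
  qed
  \<comment> \<open>Any pair of points may serve to name the common count.\<close>
  have "card (?through T) = card (?through {0, 1})" if "card T = 2" for T
    using that by (intro antisym le) simp_all
  moreover have "card b = i" if "b \<in> ?B" for b
    using that by (auto simp: blocks_of_weight_def hamming_weight_def)
  ultimately show ?thesis
    unfolding is_design_def using assms(2,3) by auto
qed

section \<open>The trace\<close>

lemma abs_trace_add:
  fixes x y :: "'a::field"
  assumes "prime p" and "CHAR('a) = p"
  shows "abs_trace p r (x + y) = abs_trace p r x + abs_trace p r y"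
proof -
  have "(x + y) ^ p ^ k = x ^ p ^ k + y ^ p ^ k" for k
    by (rule freshmans_dream') (use assms in auto)
  then show ?thesis
    by (simp add: abs_trace_def sum.distrib)
qed

lemma abs_trace_0:
  assumes "p > 0"
  shows "abs_trace p r (0::'a::field) = 0"
  using assms by (simp add: abs_trace_def power_0_left)

lemma abs_trace_sum:
  fixes f :: "'b \<Rightarrow> 'a::field"
  assumes "prime p" and "CHAR('a) = p"
  shows "abs_trace p r (sum f A) = (\<Sum>x\<in>A. abs_trace p r (f x))"
  by (induction A rule: infinite_finite_induct)
    (simp_all add: abs_trace_add[OF assms] abs_trace_0 prime_gt_0_nat[OF assms(1)])

text \<open>
  The trace is invariant under the Frobenius automorphism, which permutes its summands cyclically.
\<close>

lemma abs_trace_frobenius: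
  fixes x :: "'a::field"
  assumes "x \<in> subfield_of_order (p ^ r)"
  shows "abs_trace p r (x ^ p ^ k) = abs_trace p r x"
proof (induction k)
  case (Suc k)
  let ?y = "x ^ p ^ k"
  have "?y ^ p ^ r = (x ^ p ^ r) ^ p ^ k"
    by (simp only: power_mult[symmetric] mult.commute)
  then have "?y ^ p ^ r = ?y"
    using assms by (simp add: subfield_of_order_def)
  then have "abs_trace p r (?y ^ p) + ?y = abs_trace p r ?y + ?y"
    using sum.lessThan_Suc_shift[of "\<lambda>i. ?y ^ p ^ i" r]
    by (simp add: abs_trace_def add.commute power_mult)
  then have "abs_trace p r (?y ^ p) = abs_trace p r ?y"
    by simp
  then show ?case
    using Suc by (simp only: power_Suc2 power_mult)
qed simp

text \<open>
  Transitivity of the trace: in the field of order \<open>p ^ (2 * s)\<close>, \<open>x + x ^ p ^ s\<close> is the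
  relative trace to the subfield of order \<open>p ^ s\<close>. Its two terms contribute the lower and the
  upper half of the summands of the trace of degree \<open>2 * s\<close>.
\<close>

lemma abs_trace_relative:
  fixes x :: "'a::field"
  assumes "prime p" and "CHAR('a) = p"
  shows "abs_trace p s (x + x ^ p ^ s) = abs_trace p (2 * s) x"
proof -
  have "(\<Sum>i<s + t. x ^ p ^ i) = (\<Sum>i<s. x ^ p ^ i) + (\<Sum>i<t. x ^ p ^ (s + i))" for t
    by (induction t) (simp_all add: ac_simps)
  then have "abs_trace p (2 * s) x = (\<Sum>i<s. x ^ p ^ i) + (\<Sum>i<s. x ^ p ^ (s + i))"
    by (simp add: abs_trace_def mult_2)
  then show ?thesis
    unfolding abs_trace_add[OF assms] by (simp add: abs_trace_def power_add power_mult)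
qed

section \<open>Affine invariance of the code\<close>

lemma affine_power_Suc_prime_power:
  fixes u v x :: "'a::field"
  assumes "prime p" and "CHAR('a) = p"
  shows "(u * x + v) ^ (p ^ j + 1) =
    u ^ (p ^ j + 1) * x ^ (p ^ j + 1) + u ^ p ^ j * v * x ^ p ^ j + u * v ^ p ^ j * x
      + v ^ (p ^ j + 1)"
proof -
  have "(u * x + v) ^ p ^ j = (u * x) ^ p ^ j + v ^ p ^ j"
    by (rule freshmans_dream') (use assms in auto)
  then show ?thesis
    by (simp add: power_mult_distrib algebra_simps)
qed

lemma norm_in_subfield:
  fixes x :: "'a::finite_field"
  assumes "CARD('a) = p ^ (2 * s)"
  shows "x ^ (p ^ s + 1) \<in> subfield_of_order (p ^ s)"
proof -
  have "(x ^ (p ^ s + 1)) ^ p ^ s = x ^ p ^ (2 * s) * x ^ p ^ s"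
    by (simp add: mult_2 power_add power_mult power_mult_distrib)
  also have "\<dots> = x ^ (p ^ s + 1)"
    using finite_field_power_card_eq_same[of x] assms by simp
  finally show ?thesis
    by (simp add: subfield_of_order_def)
qed

lemma extended_kasami_code_affine:
  fixes w :: "'a::finite_field \<Rightarrow> 'a"
  assumes p: "prime p" and card: "CARD('a) = p ^ m" and m: "m = 2 * s" and "s \<ge> 1" and "l \<le> m"
    and w: "w \<in> extended_kasami_code p s m l"
  shows "(\<lambda>x. w (u * x + v)) \<in> extended_kasami_code p s m l"
proof -
  have char: "CHAR('a) = p"
    by (rule char_eq_if_card_eq) fact+
  note add [simp] = abs_trace_add[OF p char]
  have q: "y ^ p ^ m = y" for y :: 'a
    using finite_field_power_card_eq_same[of y] card by simp
  have in_m: "y \<in> subfield_of_order (p ^ m)" for y :: 'a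
    by (simp add: subfield_of_order_def q)
  obtain a b c h where w: "w = kasami_codeword p s m l a b c h"
    and a: "a \<in> subfield_of_order (p ^ s)" and h: "h \<in> subfield_of_order p"
    using w by (auto simp: extended_kasami_code_def)
  note norm = norm_in_subfield[OF card[unfolded m]]
  note closed = subfield_of_order_closed[OF p card]
  define a' where "a' = a * u ^ (p ^ s + 1)"
  define b' where "b' = b * u ^ (p ^ l + 1)"
  define d where "d = a * u * v ^ p ^ s"
  \<comment> \<open>The \<open>p ^ l\<close>-th root of the coefficient of \<open>x ^ p ^ l\<close>.\<close>
  define e where "e = (b * u ^ p ^ l * v) ^ p ^ (m - l)"
  define c' where "c' = d + e + b * u * v ^ p ^ l + c * u"
  define h' where "h' = abs_trace p s (a * v ^ (p ^ s + 1))
    + abs_trace p m (b * v ^ (p ^ l + 1) + c * v) + h"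
  have a': "a' \<in> subfield_of_order (p ^ s)"
    unfolding a'_def by (rule closed(2)[OF a norm])
  have "abs_trace p s (a * v ^ (p ^ s + 1)) \<in> subfield_of_order p"
    by (rule abs_trace_in_prime_subfield[OF p card])
      (use \<open>s \<ge> 1\<close> closed(2)[OF a norm] in simp_all)
  moreover have "abs_trace p m (b * v ^ (p ^ l + 1) + c * v) \<in> subfield_of_order p"
    by (rule abs_trace_in_prime_subfield[OF p card _ in_m]) (use m \<open>s \<ge> 1\<close> in simp)
  ultimately have h': "h' \<in> subfield_of_order p"
    unfolding h'_def using h closed(1)[where r = 1] by simp
  have quadratic_s: "abs_trace p s (a * (u * x + v) ^ (p ^ s + 1)) =
      abs_trace p s (a' * x ^ (p ^ s + 1)) + abs_trace p m (d * x)
      + abs_trace p s (a * v ^ (p ^ s + 1))" for x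
  proof -
    have "(v ^ p ^ s) ^ p ^ s = v"
      using q[of v] by (simp add: m mult_2 power_add power_mult)
    then have conj: "(d * x) ^ p ^ s = a * u ^ p ^ s * v * x ^ p ^ s"
      using a by (simp add: d_def power_mult_distrib subfield_of_order_def)
    have "a * (u * x + v) ^ (p ^ s + 1) =
        a' * x ^ (p ^ s + 1) + (d * x + (d * x) ^ p ^ s) + a * v ^ (p ^ s + 1)"
      unfolding conj affine_power_Suc_prime_power[OF p char] by (simp add: a'_def d_def algebra_simps)
    then show ?thesis
      using abs_trace_relative[OF p char, of s "d * x"] by (simp add: m)
  qed
  have quadratic_l: "abs_trace p m (b * (u * x + v) ^ (p ^ l + 1)) =
      abs_trace p m (b' * x ^ (p ^ l + 1)) + abs_trace p m ((e + b * u * v ^ p ^ l) * x)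
      + abs_trace p m (b * v ^ (p ^ l + 1))" for x
  proof -
    have "e ^ p ^ l = (b * u ^ p ^ l * v) ^ p ^ m"
      using \<open>l \<le> m\<close> by (simp add: e_def flip: power_mult power_add)
    then have root: "(e * x) ^ p ^ l = b * u ^ p ^ l * v * x ^ p ^ l"
      by (simp add: q power_mult_distrib)
    have "b * (u * x + v) ^ (p ^ l + 1) =
        b' * x ^ (p ^ l + 1) + (e * x) ^ p ^ l + b * u * v ^ p ^ l * x + b * v ^ (p ^ l + 1)"
      unfolding root affine_power_Suc_prime_power[OF p char] by (simp add: b'_def algebra_simps)
    then show ?thesis
      using abs_trace_frobenius[OF in_m, of "e * x" l] by (simp add: distrib_right)
  qed
  have "w (u * x + v) = kasami_codeword p s m l a' b' c' h' x" for x
  proof -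
    have "c * (u * x + v) = c * u * x + c * v"
      by (simp add: algebra_simps)
    then have "w (u * x + v) = abs_trace p s (a * (u * x + v) ^ (p ^ s + 1))
        + (abs_trace p m (b * (u * x + v) ^ (p ^ l + 1))
          + (abs_trace p m (c * u * x) + abs_trace p m (c * v))) + h"
      by (simp only: w kasami_codeword_def add)
    then show ?thesis
      unfolding quadratic_s quadratic_l kasami_codeword_def c'_def h'_def distrib_right add
      by (simp only: ac_simps)
  qed
  then have "(\<lambda>x. w (u * x + v)) = kasami_codeword p s m l a' b' c' h'"
    by (rule ext)
  then show ?thesis
    unfolding extended_kasami_code_def using a' h' by blast
qed

section \<open>Power sums and words of weight one\<close>

text \<open>
  Multiplication by \<open>g \<noteq> 0\<close> permutes the field, so it multiplies the power sum by \<open>g ^ n\<close> while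
  leaving it unchanged. Because \<open>X ^ n - 1\<close> has too few roots, some \<open>g\<close> has \<open>g ^ n \<noteq> 1\<close>.
\<close>

lemma sum_power_finite_field_eq_0:
  assumes "0 < n" and "n < CARD('a::finite_field) - 1"
  shows "(\<Sum>x\<in>UNIV. x ^ n :: 'a) = 0"
proof -
  have "card {x::'a. x ^ n = 1} < card (UNIV - {0::'a})"
    using card_roots_of_unity_le[OF assms(1), of "1::'a"] assms(2) by (simp add: card_Diff_singleton)
  then have "\<not> UNIV - {0::'a} \<subseteq> {x. x ^ n = 1}"
    by (metis card_mono finite not_less)
  then obtain g :: 'a where g: "g \<noteq> 0" "g ^ n \<noteq> 1"
    by auto
  have "bij ((*) g)"
    using g(1) by (intro bij_betwI[where g = "\<lambda>x. x / g"]) auto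
  then have "(\<Sum>x\<in>UNIV. x ^ n) = (\<Sum>x\<in>UNIV. (g * x) ^ n)"
    by (rule sum.reindex_bij_betw[symmetric])
  also have "\<dots> = g ^ n * (\<Sum>x\<in>UNIV. x ^ n)"
    by (simp add: power_mult_distrib sum_distrib_left)
  finally show ?thesis
    using g(2) by simp
qed

lemma sum_extended_kasami_codeword:
  fixes w :: "'a::finite_field \<Rightarrow> 'a"
  assumes p: "prime p" "odd p" and card: "CARD('a) = p ^ m" and m: "m = 2 * s" "m \<ge> 4"
    and l: "l \<le> m - 1" and w: "w \<in> extended_kasami_code p s m l"
  shows "(\<Sum>x\<in>UNIV. w x) = 0"
proof -
  have char: "CHAR('a) = p"
    by (rule char_eq_if_card_eq) fact+
  note tr = abs_trace_sum[OF p(1) char]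
  have tr0: "abs_trace p r (0::'a) = 0" for r
    using p(1) by (simp add: abs_trace_0 prime_gt_0_nat)
  obtain a b c h where w: "w = kasami_codeword p s m l a b c h"
    using w by (auto simp: extended_kasami_code_def)
  have "p \<ge> 3"
    using p prime_ge_2_nat[of p] by (cases "p = 2") auto
  have small: "p ^ j + 1 < CARD('a) - 1" if "j \<le> m - 1" for j
  proof -
    have "p ^ j \<le> p ^ (m - 1)"
      using that \<open>p \<ge> 3\<close> by (intro power_increasing) simp_all
    moreover have "3 ^ 1 \<le> p ^ (m - 1)"
      using \<open>p \<ge> 3\<close> m(2) by (intro order_trans[OF power_mono power_increasing]) simp_all
    moreover have "3 * p ^ (m - 1) \<le> p ^ m"
      using \<open>p \<ge> 3\<close> m(2) by (cases m) simp_all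
    ultimately show ?thesis
      using card by simp
  qed
  have vanish: "(\<Sum>x\<in>UNIV. y * x ^ n :: 'a) = 0" if "0 < n" "n < CARD('a) - 1" for y n
    using sum_power_finite_field_eq_0[OF that] by (simp flip: sum_distrib_left)
  have "1 < CARD('a) - 1"
    using small[of 0] by simp
  then have linear: "(\<Sum>x\<in>UNIV. c * x) = 0"
    using vanish[of 1 c] by simp
  have quadratic: "(\<Sum>x\<in>UNIV. y * x ^ (p ^ j + 1) :: 'a) = 0" if "j \<le> m - 1" for y j
    by (rule vanish[OF _ small[OF that]]) simp
  have "(\<Sum>x\<in>(UNIV::'a set). h) = of_nat CARD('a) * h"
    by simp
  also have "of_nat CARD('a) = (0::'a)"
    using CHAR_dvd_CARD[where ?'a = 'a] by (simp only: of_nat_eq_0_iff_char_dvd)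
  finally have const: "(\<Sum>x\<in>(UNIV::'a set). h) = 0"
    by simp
  have "(\<Sum>x\<in>UNIV. w x) = abs_trace p s (\<Sum>x\<in>UNIV. a * x ^ (p ^ s + 1))
      + abs_trace p m ((\<Sum>x\<in>UNIV. b * x ^ (p ^ l + 1)) + (\<Sum>x\<in>UNIV. c * x))
      + (\<Sum>x\<in>(UNIV::'a set). h)"
    unfolding w kasami_codeword_def by (simp only: sum.distrib[symmetric] tr)
  also have "\<dots> = 0"
    using m l by (simp only: quadratic linear const tr0 add_0_right)
  finally show ?thesis .
qed

lemma hamming_weight_neq_1_if_sum_eq_0:
  fixes w :: "'a::finite \<Rightarrow> 'b::comm_monoid_add"
  assumes "(\<Sum>x\<in>UNIV. w x) = 0"
  shows "hamming_weight w \<noteq> 1"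
proof
  assume "hamming_weight w = 1"
  then obtain x where x: "codeword_support w = {x}"
    by (auto simp: hamming_weight_def card_1_singleton_iff)
  have "(\<Sum>y\<in>UNIV. w y) = (\<Sum>y\<in>codeword_support w. w y)"
    by (rule sum.mono_neutral_right) (auto simp: codeword_support_def)
  then have "w x = 0"
    using assms x by simp
  then show False
    using x by (auto simp: codeword_support_def)
qed

section \<open>The design\<close>

theorem theorem8:
  fixes p s m l i :: nat
  assumes "prime p" and "odd p"
    and "s \<ge> 1" and "m = 2 * s" and "m \<ge> 4"
    and "1 \<le> l" and "l \<le> m - 1" and "l \<noteq> s"
    and "CARD('a::finite_field) = p ^ m"
    and "i > 0"
    and "\<exists>w \<in> (extended_kasami_code p s m l :: ('a \<Rightarrow> 'a) set). hamming_weight w = i"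
  shows "\<exists>lam. is_design 2 (p ^ m) i lam (UNIV :: 'a set)
           (blocks_of_weight (extended_kasami_code p s m l) i)"
proof -
  obtain w :: "'a \<Rightarrow> 'a" where w: "w \<in> extended_kasami_code p s m l" "hamming_weight w = i"
    using assms(11) by blast
  have "i \<noteq> 1"
    using hamming_weight_neq_1_if_sum_eq_0
      sum_extended_kasami_codeword[OF assms(1,2,9,4,5,7) w(1)] w(2) by blast
  then have "2 \<le> i"
    using \<open>i > 0\<close> by simp
  moreover have "i \<le> CARD('a)"
    using w(2) by (auto simp: hamming_weight_def intro: card_mono)
  moreover have "(\<lambda>x. w (u * x + v)) \<in> extended_kasami_code p s m l"
    if "w \<in> extended_kasami_code p s m l" for w :: "'a \<Rightarrow> 'a" and u v
    using \<open>l \<le> m - 1\<close> by (intro extended_kasami_code_affine[OF assms(1,9,4,3) _ that]) simp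
  ultimately show ?thesis
    unfolding assms(9)[symmetric] by (intro affine_invariant_code_design)
qed

end
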